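(* Let $T$ be an $\mathbb{N}^\star$-valued random variable with $\mathbb{E}T<\infty$ and $\gcd\{k\ge 1:\mathbb{P}(T=k)>0\}=1$, let $\boldsymbol{\xi}=(\xi_i)_{i\ge0}$ be the undelayed renewal sequence with inter-arrival $T$, and let $(R_i)_{i\ge0}$ be i.i.d. copies of an $\mathbb{N}$-valued random variable $R$ with $\mathbb{P}(R=0)>0$, independent of $\boldsymbol{\xi}$. Put $\alpha_n:=\mathbb{P}(R\le n)$ for $n\ge0$, and let $\mathcal{A}$ be the coverage event. If $$\limsup_{n\to\infty}\, n(\mathbb{E}T)^{-1}(1-\alpha_n)<1,$$ then $\mathbb{P}(\mathcal{A})=0$.
   Context: $\mathbb{N}=\{0,1,2,\ldots\}$ and $\mathbb{N}^\star=\{1,2,\ldots\}$. The undelayed renewal sequence $\boldsymbol{\xi}=(\xi_i)_{i\ge0}$ with inter-arrival $T$ is the binary process defined as follows: let $(T_k)_{k\ge1}$ be i.i.d. copies of $T$; set $\xi_0=1$, and for $i\ge1$ let $\xi_i=1$ if there exists $n\ge1$ with $\sum_{k=1}^nT_k=i$, and $\xi_i=0$ otherwise. For $i\ge0$ let $\mathcal{C}_i$ be the random integer interval $\mathcal{C}_i=\{i+1,\ldots,i+R_i\}$ if $\xi_i=1$ and $R_i\ge1$, and $\mathcal{C}_i=\emptyset$ if $\xi_i=0$ or $R_i=0$. The coverage event is $\mathcal{A}=\{\bigcup_{i\ge0}\mathcal{C}_i=\mathbb{N}^\star\}$. *)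

theory Defs
  imports "HOL-Probability.Probability"
begin

text \<open>\<open>Ts k \<omega>\<close> is the \<open>k\<close>-th inter-arrival time for \<open>k \<ge> 1\<close>; the entry \<open>Ts 0\<close> plays no role.\<close>

definition renewal :: "(nat \<Rightarrow> 'a \<Rightarrow> nat) \<Rightarrow> nat \<Rightarrow> 'a \<Rightarrow> nat" where
  "renewal Ts i \<omega> = (if i = 0 \<or> (\<exists>n\<ge>1. (\<Sum>k=1..n. Ts k \<omega>) = i) then 1 else 0)"

definition cover_interval :: "(nat \<Rightarrow> 'a \<Rightarrow> nat) \<Rightarrow> (nat \<Rightarrow> 'a \<Rightarrow> nat) \<Rightarrow> nat \<Rightarrow> 'a \<Rightarrow> nat set" where
  "cover_interval \<xi> Rs i \<omega> =
     (if \<xi> i \<omega> = 1 \<and> Rs i \<omega> \<ge> 1 then {i + 1..i + Rs i \<omega>} else {})"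

definition coverage_event ::
    "'a measure \<Rightarrow> (nat \<Rightarrow> 'a \<Rightarrow> nat) \<Rightarrow> (nat \<Rightarrow> 'a \<Rightarrow> nat) \<Rightarrow> 'a set" where
  "coverage_event M \<xi> Rs = {\<omega> \<in> space M. (\<Union>i. cover_interval \<xi> Rs i \<omega>) = {1..}}"

end

theory Submission imports Defs "HOL-Real_Asymp.Real_Asymp" begin

text \<open>
  Let \<open>S\<^sub>j\<close> be the arrival times. Since \<open>R\<close> is independent of the renewal sequence, the pairs
  \<open>(T\<^sub>j\<^sub>+\<^sub>1, R(S\<^sub>j))\<close> are i.i.d., so everything can be read off an i.i.d. list of (gap, reach) pairs.
  Let \<open>u\<^sub>n\<close> be the probability that no interval started before \<open>S\<^sub>n\<close> reaches beyond \<open>S\<^sub>n\<close>.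
  The events ``\<open>S\<^sub>n\<close> is such a time, \<open>R(S\<^sub>n) = 0\<close>, and the process started afresh at \<open>S\<^sub>n\<^sub>+\<^sub>1\<close> covers
  everything'' are disjoint, whence \<open>P(A) P(R = 0) (\<Sum>n<N. u\<^sub>n) \<le> 1\<close> for every \<open>N\<close>.
  Reading the list backwards, \<open>u\<^sub>n\<close> is the expectation of the product of \<open>\<alpha>(S\<^sub>l)\<close> over \<open>l = 1..n\<close>.
  By Jensen's inequality it is at least \<open>exp (- (\<Sum>l=1..n. E (- ln \<alpha>(S\<^sub>l))))\<close>. The hypothesis on \<open>\<alpha>\<close>
  together with a Chernoff bound for \<open>S\<^sub>l\<close> gives \<open>E (- ln \<alpha>(S\<^sub>l)) \<le> 1 / l\<close> for large \<open>l\<close>. Hence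
  \<open>u\<^sub>n \<ge> C / n\<close>, the sum of the \<open>u\<^sub>n\<close> diverges, and \<open>P(A) = 0\<close>.
\<close>

section \<open>Discrete distributions\<close>

text \<open>The points of mass zero are countably many, so together they form a null set and the law
  is carried by its atoms.\<close>

lemma ex_measure_pmf_eq_distr:
  fixes X :: "'a \<Rightarrow> 'b :: countable"
  assumes "prob_space M" "X \<in> measurable M (count_space UNIV)"
  shows "\<exists>p. measure_pmf p = distr M (count_space UNIV) X"
proof -
  let ?N = "distr M (count_space UNIV) X"
  interpret N: prob_space ?N
    using assms by (rule prob_space.prob_space_distr)
  have "(\<Union>x\<in>{x. measure ?N {x} = 0}. {x}) \<in> null_sets ?N"
    by (intro null_sets_UN') (auto simp: null_sets_def N.emeasure_eq_measure)
  then have "AE x in ?N. measure ?N {x} \<noteq> 0"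
    by (rule AE_I') auto
  then show ?thesis
    using N.prob_space_axioms by (intro exI[of _ "Abs_pmf ?N"] Abs_pmf_inverse) auto
qed

lemma pmf_replicate_pmf:
  "length xs = n \<Longrightarrow> pmf (replicate_pmf n p) xs = (\<Prod>i<n. pmf p (xs ! i))"
proof (induction n arbitrary: xs)
  case (Suc n)
  then obtain y ys where xs: "xs = y # ys" "length ys = n"
    by (auto simp: length_Suc_conv)
  have "replicate_pmf (Suc n) p = map_pmf (\<lambda>(x, xs). x # xs) (pair_pmf p (replicate_pmf n p))"
    by (simp add: pair_pmf_def map_pmf_def bind_assoc_pmf bind_return_pmf)
  also have "pmf \<dots> ((\<lambda>(x, xs). x # xs) (y, ys)) = pmf (pair_pmf p (replicate_pmf n p)) (y, ys)"
    by (intro pmf_map_inj' injI) auto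
  finally show ?case
    using xs Suc.IH by (simp add: pmf_pair prod.lessThan_Suc_shift del: prod.lessThan_Suc replicate_pmf.simps)
qed simp

lemma sum_list_ge_of_set_replicate_pmf:
  assumes "ts \<in> set_pmf (replicate_pmf l p)" "0 \<notin> set_pmf (p :: nat pmf)"
  shows "l \<le> sum_list ts"
proof -
  have "length ts = l" "\<forall>t\<in>set ts. 1 \<le> t"
    using assms by (auto simp: set_replicate_pmf Suc_le_eq intro!: gr0I)
  then show ?thesis by (induction ts arbitrary: l) auto
qed

lemma measure_pmf_atMost_pos:
  assumes "pmf q 0 > 0"
  shows "measure (measure_pmf q) {..n :: nat} > 0"
  using assms measure_pmf.finite_measure_mono[of "{0}" "{..n}" q] by (simp add: measure_pmf_single)

text \<open>Jensen's inequality for \<open>exp\<close>, from the tangent at \<open>m\<close>; no subtraction occurs in \<open>ennreal\<close>.\<close>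

lemma nn_integral_exp_neg_ge:
  fixes W :: "'a \<Rightarrow> ennreal" and N :: "'a pmf"
  assumes "(\<integral>\<^sup>+ x. W x \<partial>N) \<le> ennreal m" "m \<ge> 0" "\<And>x. W x < \<infinity>"
  shows "ennreal (exp (- m)) \<le> (\<integral>\<^sup>+ x. ennreal (exp (- enn2real (W x))) \<partial>N)" (is "_ \<le> ?u")
proof -
  have *: "ennreal (exp (- m) * (1 + m)) \<le>
      ennreal (exp (- enn2real (W x))) + ennreal (exp (- m)) * W x" for x
  proof -
    define w where "w = enn2real (W x)"
    have w: "W x = ennreal w" "w \<ge> 0"
      using assms(3)[of x] by (auto simp: w_def)
    have "exp (- m) * (1 + (m - w)) \<le> exp (- m) * exp (m - w)"
      by (intro mult_left_mono exp_ge_add_one_self) auto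
    also have "\<dots> = exp (- w)" by (simp flip: exp_add)
    finally have "exp (- m) * (1 + m) \<le> exp (- w) + exp (- m) * w"
      by (simp add: algebra_simps)
    then show ?thesis
      unfolding w_def[symmetric] w(1) using w(2)
      by (simp flip: ennreal_mult ennreal_plus)
  qed
  have "ennreal (exp (- m) * (1 + m)) = (\<integral>\<^sup>+ x. ennreal (exp (- m) * (1 + m)) \<partial>N)"
    by simp
  also have "\<dots> \<le> (\<integral>\<^sup>+ x. ennreal (exp (- enn2real (W x))) + ennreal (exp (- m)) * W x \<partial>N)"
    by (intro nn_integral_mono *)
  also have "\<dots> = ?u + ennreal (exp (- m)) * (\<integral>\<^sup>+ x. W x \<partial>N)"
    by (simp add: nn_integral_add nn_integral_cmult)
  also have "\<dots> \<le> ?u + ennreal (exp (- m) * m)"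
    using assms by (simp add: ennreal_mult mult_left_mono)
  finally have "ennreal (exp (- m)) + ennreal (exp (- m) * m) \<le> ?u + ennreal (exp (- m) * m)"
    using assms(2) by (simp add: algebra_simps flip: ennreal_plus)
  then show ?thesis by (simp add: ennreal_add_left_cancel_le add.commute)
qed

lemma (in prob_space) prob_indep_vars_eq:
  fixes X :: "nat \<Rightarrow> 'a \<Rightarrow> nat" and k :: nat
  assumes "indep_vars (\<lambda>_. count_space UNIV) X I" "inj_on f {..<k}" "f ` {..<k} \<subseteq> I"
    and p: "\<And>i. i \<in> I \<Longrightarrow> distr M (count_space UNIV) (X i) = measure_pmf p"
  shows "prob {\<omega> \<in> space M. \<forall>j<k. X (f j) \<omega> = x j} = (\<Prod>j<k. pmf p (x j))"
proof (cases "k = 0")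
  case True
  then show ?thesis by (simp add: prob_space)
next
  case False
  \<comment> \<open>\<open>indep_varsD\<close> wants a nonempty index set and the prescribed values
    as a function of the index; \<open>?g\<close> turns the index \<open>f j\<close> back into
    \<open>j\<close>.\<close>
  let ?g = "the_inv_into {..<k} f"
  have g: "?g (f j) = j" if "j < k" for j
    using assms(2) that by (simp add: the_inv_into_f_f)
  have rv: "X (f j) \<in> measurable M (count_space UNIV)" if "j < k" for j
    using assms(1,3) that by (auto simp: indep_vars_def)
  have "{\<omega> \<in> space M. \<forall>j<k. X (f j) \<omega> = x j} = (\<Inter>i\<in>f ` {..<k}. X i -` {x (?g i)} \<inter> space M)"
    using False g by auto
  also have "prob \<dots> = (\<Prod>i\<in>f ` {..<k}. prob (X i -` {x (?g i)} \<inter> space M))"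
    using assms False by (intro indep_varsD) auto
  also have "\<dots> = (\<Prod>j<k. prob (X (f j) -` {x j} \<inter> space M))"
    using assms(2) g by (simp add: prod.reindex)
  also have "\<dots> = (\<Prod>j<k. measure (distr M (count_space UNIV) (X (f j))) {x j})"
    using rv by (intro prod.cong refl) (simp add: measure_distr)
  also have "\<dots> = (\<Prod>j<k. pmf p (x j))"
    using p assms(3) by (intro prod.cong refl) (auto simp: pmf.rep_eq)
  finally show ?thesis .
qed

section \<open>Lists of gaps and reaches\<close>

text \<open>
  An entry \<open>(t, r)\<close> of a list stands for an arrival followed by a gap \<open>t\<close> to the next arrival, whose
  interval has length \<open>r\<close>. In \<open>spent\<close> no interval reaches beyond the end of the last gap; in
  \<open>reached\<close> some interval contains that end point.
\<close>

fun spent :: "(nat \<times> nat) list \<Rightarrow> bool" where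
  "spent [] \<longleftrightarrow> True"
| "spent (z # zs) \<longleftrightarrow> snd z \<le> fst z + sum_list (map fst zs) \<and> spent zs"

fun reached :: "(nat \<times> nat) list \<Rightarrow> bool" where
  "reached [] \<longleftrightarrow> False"
| "reached (z # zs) \<longleftrightarrow> fst z + sum_list (map fst zs) \<le> snd z \<or> reached zs"

text \<open>Coverage is tested only at the arrival times that end a gap: necessary for full
  coverage, and enough for the uniqueness of fresh starts.\<close>

definition covered :: "(nat \<times> nat) list \<Rightarrow> bool" where
  "covered zs \<longleftrightarrow> (\<forall>n\<in>{1..length zs}. reached (take n zs))"

lemma spent_append: "spent (xs @ ys) \<Longrightarrow> spent ys"
  by (induction xs) auto

text \<open>The intervals in \<open>zs\<close> stop by the end of its last gap, the new interval is
  empty, and the positive new gap moves the end point past them all.\<close>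

lemma not_reached_snoc:
  assumes "spent zs" "fst z \<ge> 1" "snd z = 0"
  shows "\<not> reached (zs @ [z])"
  using assms by (induction zs) auto

text \<open>
  A fresh start at \<open>n\<close> makes step \<open>n\<close> uncovered even from an earlier fresh start, because the
  intermediate intervals are spent by then; this gives uniqueness.
\<close>

definition fresh_start :: "nat \<Rightarrow> (nat \<times> nat) list \<Rightarrow> bool" where
  "fresh_start n zs \<longleftrightarrow> spent (take n zs) \<and> fst (zs ! n) \<ge> 1 \<and> snd (zs ! n) = 0 \<and>
     covered (drop (Suc n) zs)"

lemma fresh_start_unique:
  assumes "fresh_start m zs" "fresh_start n zs" "n < length zs"
  shows "\<not> m < n"
proof
  assume "m < n"
  \<comment> \<open>The entries strictly between \<open>m\<close> and \<open>n\<close>. They are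
    spent as a suffix of \<open>take n zs\<close>, while \<open>ws @ [zs ! n]\<close> is one of the
    prefixes tested by \<open>covered\<close>.\<close>
  define ws where "ws = take (n - Suc m) (drop (Suc m) zs)"
  have eq: "take n zs = take (Suc m) zs @ ws"
    using take_add[of "Suc m" "n - Suc m" zs] \<open>m < n\<close> by (simp add: ws_def)
  have "spent ws"
    using assms(2) spent_append unfolding fresh_start_def eq by blast
  moreover have "take (n - m) (drop (Suc m) zs) = ws @ [zs ! n]"
    using take_Suc_conv_app_nth[of "n - Suc m" "drop (Suc m) zs"] \<open>m < n\<close> assms(3)
    by (simp add: ws_def Suc_diff_Suc)
  moreover have "n - m \<in> {1..length (drop (Suc m) zs)}"
    using assms(3) \<open>m < n\<close> by auto
  then have "reached (take (n - m) (drop (Suc m) zs))"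
    using assms(1) unfolding fresh_start_def covered_def by blast
  ultimately show False
    using not_reached_snoc assms(2) unfolding fresh_start_def by auto
qed

lemma reached_iff:
  "reached zs \<longleftrightarrow> (\<exists>j<length zs. sum_list (map fst (drop j zs)) \<le> snd (zs ! j))"
  by (induction zs) (auto simp: less_Suc_eq_0_disj)

section \<open>The renewal inequality from disjoint fresh starts\<close>

lemma emeasure_fresh_start:
  fixes Z :: "(nat \<times> nat) pmf"
  shows "emeasure (replicate_pmf (n + Suc m) Z) {zs. fresh_start n zs} =
    emeasure (replicate_pmf n Z) {zs. spent zs} *
    (emeasure Z {z. fst z \<ge> 1 \<and> snd z = 0} * emeasure (replicate_pmf m Z) {zs. covered zs})"
proof -
  \<comment> \<open>The three conditions concern disjoint blocks of an i.i.d. list, so the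
    probability factors.\<close>
  have *: "fresh_start (length xs) (xs @ z # ys) \<longleftrightarrow>
      spent xs \<and> (fst z \<ge> 1 \<and> snd z = 0) \<and> covered ys" for xs ys z
    by (auto simp: fresh_start_def)
  have "emeasure (replicate_pmf (n + Suc m) Z) {zs. fresh_start n zs} =
     (\<integral>\<^sup>+ xs. \<integral>\<^sup>+ z. \<integral>\<^sup>+ ys. indicator {zs. fresh_start n zs} (xs @ z # ys)
        \<partial>replicate_pmf m Z \<partial>Z \<partial>replicate_pmf n Z)"
    unfolding replicate_pmf_distrib by (simp add: bind_assoc_pmf bind_return_pmf)
  also have "\<dots> = (\<integral>\<^sup>+ xs. \<integral>\<^sup>+ z. \<integral>\<^sup>+ ys. indicator {zs. spent zs} xs *
      (indicator {z. fst z \<ge> 1 \<and> snd z = 0} z * indicator {zs. covered zs} ys)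
        \<partial>replicate_pmf m Z \<partial>Z \<partial>replicate_pmf n Z)"
    by (rule nn_integral_cong_AE)
      (auto simp: AE_measure_pmf_iff set_replicate_pmf * intro!: nn_integral_cong
        split: split_indicator)
  finally show ?thesis
    by (simp add: nn_integral_cmult nn_integral_multc)
qed

lemma sum_emeasure_fresh_start_le_1:
  fixes Z :: "(nat \<times> nat) pmf"
  shows "(\<Sum>n<N. emeasure (replicate_pmf N Z) {zs. fresh_start n zs}) \<le> 1"
proof -
  \<comment> \<open>Uniqueness requires \<open>n < length zs\<close>, and the length is
    \<open>N\<close> only almost surely; hence it is made part of the event.\<close>
  define F where "F n = {zs. length zs = N \<and> fresh_start n zs}" for n
  have "(\<Sum>n<N. emeasure (replicate_pmf N Z) {zs. fresh_start n zs}) =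
      (\<Sum>n<N. emeasure (replicate_pmf N Z) (F n))"
    by (intro sum.cong refl emeasure_eq_AE)
      (auto simp: AE_measure_pmf_iff set_replicate_pmf F_def)
  also have "\<dots> = emeasure (replicate_pmf N Z) (\<Union>n\<in>{..<N}. F n)"
    using fresh_start_unique
    by (intro sum_emeasure) (auto simp: disjoint_family_on_def F_def, metis linorder_neqE_nat)
  also have "\<dots> \<le> 1"
    by (rule measure_pmf.emeasure_le_1)
  finally show ?thesis .
qed

text \<open>A fresh start at \<open>n\<close> in a list of length \<open>N\<close> leaves
  \<open>N - Suc n\<close> entries, so \<open>a\<close> has to bound the covered probability for
  every length.\<close>

lemma renewal_sum_le_1:
  fixes Z :: "(nat \<times> nat) pmf"
  assumes "\<And>m. a \<le> emeasure (replicate_pmf m Z) {zs. covered zs}"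
  shows "(\<Sum>n<N. emeasure (replicate_pmf n Z) {zs. spent zs}) *
    (emeasure Z {z. fst z \<ge> 1 \<and> snd z = 0} * a) \<le> 1"
proof -
  have "emeasure (replicate_pmf n Z) {zs. spent zs} *
      (emeasure Z {z. fst z \<ge> 1 \<and> snd z = 0} * a) \<le>
      emeasure (replicate_pmf N Z) {zs. fresh_start n zs}" if "n < N" for n
  proof -
    have "N = n + Suc (N - Suc n)" using that by simp
    moreover have "emeasure (replicate_pmf n Z) {zs. spent zs} *
        (emeasure Z {z. fst z \<ge> 1 \<and> snd z = 0} * a) \<le>
        emeasure (replicate_pmf (n + Suc (N - Suc n)) Z) {zs. fresh_start n zs}"
      unfolding emeasure_fresh_start by (intro mult_left_mono assms zero_le)
    ultimately show ?thesis by simp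
  qed
  then have "(\<Sum>n<N. emeasure (replicate_pmf n Z) {zs. spent zs}) *
      (emeasure Z {z. fst z \<ge> 1 \<and> snd z = 0} * a) \<le>
      (\<Sum>n<N. emeasure (replicate_pmf N Z) {zs. fresh_start n zs})"
    unfolding sum_distrib_right by (intro sum_mono) auto
  also have "\<dots> \<le> 1" by (rule sum_emeasure_fresh_start_le_1)
  finally show ?thesis .
qed

section \<open>Lower bound for the renewal probabilities\<close>

text \<open>The conditional probability of \<open>spent\<close> given the gaps \<open>ts\<close>,
  for independent reaches with law \<open>q\<close>.\<close>

definition suffix_weight :: "nat pmf \<Rightarrow> nat list \<Rightarrow> ennreal" where
  "suffix_weight q ts = (\<Prod>i<length ts. emeasure q {..sum_list (drop i ts)})"

lemma suffix_weight_Nil [simp]: "suffix_weight q [] = 1"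
  by (simp add: suffix_weight_def)

lemma suffix_weight_Cons [simp]:
  "suffix_weight q (t # ts) = emeasure q {..t + sum_list ts} * suffix_weight q ts"
  unfolding suffix_weight_def by (simp add: prod.lessThan_Suc_shift del: prod.lessThan_Suc)

text \<open>The test function \<open>h\<close> carries the induction: the condition on the first
  reach involves the sum of all gaps and is absorbed into a new \<open>h\<close>.\<close>

lemma nn_integral_spent:
  fixes p q :: "nat pmf" and h :: "nat list \<Rightarrow> ennreal"
  shows "(\<integral>\<^sup>+ zs. indicator {zs. spent zs} zs * h (map fst zs) \<partial>replicate_pmf k (pair_pmf p q)) =
    (\<integral>\<^sup>+ ts. suffix_weight q ts * h ts \<partial>replicate_pmf k p)"
proof (induction k arbitrary: h)
  case (Suc k)
  let ?Z = "pair_pmf p q"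
  have "(\<integral>\<^sup>+ zs. indicator {zs. spent zs} zs * h (map fst zs) \<partial>replicate_pmf (Suc k) ?Z) =
     (\<integral>\<^sup>+ t. \<integral>\<^sup>+ r. \<integral>\<^sup>+ zs. indicator {zs. spent zs} zs *
       (indicator {..t + sum_list (map fst zs)} r * h (t # map fst zs))
         \<partial>replicate_pmf k ?Z \<partial>q \<partial>p)"
    by (auto simp: nn_integral_pair_pmf' intro!: nn_integral_cong split: split_indicator)
  also have "\<dots> = (\<integral>\<^sup>+ t. \<integral>\<^sup>+ r. \<integral>\<^sup>+ ts. suffix_weight q ts *
       (indicator {..t + sum_list ts} r * h (t # ts)) \<partial>replicate_pmf k p \<partial>q \<partial>p)"
    by (subst Suc.IH[where h = "\<lambda>ts. indicator {.._ + sum_list ts} _ * h (_ # ts)"]) simp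
  also have "\<dots> = (\<integral>\<^sup>+ t. \<integral>\<^sup>+ x. (case x of (r, ts) \<Rightarrow> suffix_weight q ts *
       (indicator {..t + sum_list ts} r * h (t # ts))) \<partial>pair_pmf q (replicate_pmf k p) \<partial>p)"
    by (simp add: nn_integral_pair_pmf')
  also have "\<dots> = (\<integral>\<^sup>+ t. \<integral>\<^sup>+ ts. \<integral>\<^sup>+ r. suffix_weight q ts *
       (indicator {..t + sum_list ts} r * h (t # ts)) \<partial>q \<partial>replicate_pmf k p \<partial>p)"
    by (subst pair_commute_pmf) (simp add: nn_integral_pair_pmf' case_prod_beta)
  also have "\<dots> = (\<integral>\<^sup>+ ts. suffix_weight q ts * h ts \<partial>replicate_pmf (Suc k) p)"
    by (auto simp: nn_integral_cmult nn_integral_multc mult_ac intro!: nn_integral_cong)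
  finally show ?case .
qed simp

text \<open>A suffix of an i.i.d. list is again i.i.d., so the suffix sums have the marginal laws of
  the arrival times in reverse order; linearity does the rest.\<close>

lemma nn_integral_sum_list_suffixes:
  fixes p :: "nat pmf" and c :: "nat \<Rightarrow> ennreal"
  shows "(\<integral>\<^sup>+ ts. (\<Sum>i<k. c (sum_list (drop i ts))) \<partial>replicate_pmf k p) =
    (\<Sum>l=1..k. \<integral>\<^sup>+ ts. c (sum_list ts) \<partial>replicate_pmf l p)"
proof (induction k)
  case (Suc k)
  have "(\<integral>\<^sup>+ ts. (\<Sum>i<Suc k. c (sum_list (drop i ts))) \<partial>replicate_pmf (Suc k) p) =
     (\<integral>\<^sup>+ t. \<integral>\<^sup>+ ts. c (t + sum_list ts) + (\<Sum>i<k. c (sum_list (drop i ts)))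
        \<partial>replicate_pmf k p \<partial>p)"
    by (simp add: sum.lessThan_Suc_shift del: sum.lessThan_Suc)
  also have "\<dots> = (\<integral>\<^sup>+ ts. c (sum_list ts) \<partial>replicate_pmf (Suc k) p) +
      (\<integral>\<^sup>+ ts. (\<Sum>i<k. c (sum_list (drop i ts))) \<partial>replicate_pmf k p)"
    by (subst nn_integral_add; simp)+
  finally show ?case using Suc.IH by (simp add: add.commute)
qed simp

section \<open>A Chernoff bound for the arrival times\<close>

lemma nn_integral_exp_sum_list:
  fixes p :: "nat pmf" and s :: real
  shows "(\<integral>\<^sup>+ ts. ennreal (exp (- s * real (sum_list ts))) \<partial>replicate_pmf k p) =
    (\<integral>\<^sup>+ t. ennreal (exp (- s * real t)) \<partial>p) ^ k"
proof (induction k)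
  case (Suc k)
  have "(\<integral>\<^sup>+ ts. ennreal (exp (- s * real (sum_list ts))) \<partial>replicate_pmf (Suc k) p) =
     (\<integral>\<^sup>+ t. \<integral>\<^sup>+ ts. ennreal (exp (- s * real t)) * ennreal (exp (- s * real (sum_list ts)))
        \<partial>replicate_pmf k p \<partial>p)"
    by (simp add: algebra_simps exp_diff flip: ennreal_mult'' exp_add)
  also have "\<dots> = (\<integral>\<^sup>+ t. ennreal (exp (- s * real t)) \<partial>p) *
      (\<integral>\<^sup>+ ts. ennreal (exp (- s * real (sum_list ts))) \<partial>replicate_pmf k p)"
    by (simp add: nn_integral_cmult nn_integral_multc)
  finally show ?case by (simp only: Suc.IH power_Suc)
qed simp

text \<open>As s tends to 0, (1 - E exp (-sT)) / s tends to E T by dominated convergence, with T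
  itself as dominating function. Then 1 - sy \<le> exp (-sy) gives the claim.\<close>

lemma integral_exp_less:
  fixes p :: "nat pmf"
  assumes int: "integrable p real" and y: "y < measure_pmf.expectation p real"
  shows "\<exists>s>0. measure_pmf.expectation p (\<lambda>t. exp (- s * real t)) < exp (- s * y)"
proof -
  have "(\<lambda>n. measure_pmf.expectation p (\<lambda>t. real (Suc n) * (1 - exp (- (1 / real (Suc n)) * real t))))
     \<longlonglongrightarrow> measure_pmf.expectation p real"
  proof (rule integral_dominated_convergence[where w = real])
    show "AE t in p. (\<lambda>n. real (Suc n) * (1 - exp (- (1 / real (Suc n)) * real t))) \<longlonglongrightarrow> real t"
    proof (rule AE_I2)
      fix t
      show "(\<lambda>n. real (Suc n) * (1 - exp (- (1 / real (Suc n)) * real t))) \<longlonglongrightarrow> real t"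
        by real_asymp
    qed
    show "AE t in p. norm (real (Suc n) * (1 - exp (- (1 / real (Suc n)) * real t))) \<le> real t" for n
    proof (rule AE_I2)
      fix t
      have "1 - exp (- (1 / real (Suc n)) * real t) \<le> (1 / real (Suc n)) * real t"
        using exp_ge_add_one_self[of "- (1 / real (Suc n)) * real t"] by linarith
      then have "real (Suc n) * (1 - exp (- (1 / real (Suc n)) * real t)) \<le>
          real (Suc n) * ((1 / real (Suc n)) * real t)"
        by (intro mult_left_mono) auto
      moreover have "1 - exp (- (1 / real (Suc n)) * real t) \<ge> 0"
        by simp
      ultimately show "norm (real (Suc n) * (1 - exp (- (1 / real (Suc n)) * real t))) \<le> real t"
        by (simp add: abs_mult)
    qed
  qed (use int in auto)
  then have "\<forall>\<^sub>F n in sequentially. y < measure_pmf.expectation p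
      (\<lambda>t. real (Suc n) * (1 - exp (- (1 / real (Suc n)) * real t)))"
    using y by (rule order_tendstoD)
  then obtain n where n: "y < measure_pmf.expectation p
      (\<lambda>t. real (Suc n) * (1 - exp (- (1 / real (Suc n)) * real t)))"
    using eventually_happens by force
  define s where "s = 1 / real (Suc n)"
  have s: "s > 0" by (simp add: s_def)
  have i: "integrable p (\<lambda>t. exp (- s * real t))"
    by (rule measure_pmf.integrable_const_bound[where B = 1]) (use s in auto)
  have "y < (1 / s) * (1 - measure_pmf.expectation p (\<lambda>t. exp (- s * real t)))"
    using n i by (simp add: s_def)
  then have "measure_pmf.expectation p (\<lambda>t. exp (- s * real t)) < 1 + (- s * y)"
    using s by (simp add: field_simps)
  also have "\<dots> \<le> exp (- s * y)" by (rule exp_ge_add_one_self)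
  finally show ?thesis using s by blast
qed

text \<open>Let S be the sum of the gaps and split at S = y l, with \<open>y\<close> the midpoint of
  \<open>c * \<mu>\<close> and \<open>\<mu>\<close>. Above this level the integrand is at most
  \<open>c * \<mu> / y < 1\<close> times 1 / l. Below it, S \<ge> l still gives order 1 / l, on an
  event of exponentially small probability.\<close>

lemma expectation_inverse_sum_list_le:
  fixes p :: "nat pmf" and c :: real
  defines "\<mu> \<equiv> measure_pmf.expectation p real"
  assumes int: "integrable p real" and pos: "\<mu> > 0" and "0 \<notin> set_pmf p"
    and c: "0 \<le> c" "c < 1"
  shows "\<forall>\<^sub>F l in sequentially.
    (\<integral>\<^sup>+ ts. ennreal (c * \<mu> / real (sum_list ts)) \<partial>replicate_pmf l p) \<le> ennreal (1 / real l)"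
proof -
  define y where "y = \<mu> * (1 + c) / 2"
  have "c * \<mu> / y = 2 * c / (1 + c)"
    using c pos by (simp add: y_def)
  then have y: "0 < y" "y < \<mu>" "c * \<mu> / y < 1"
    using c pos by (auto simp: y_def)
  obtain s where s: "s > 0" "measure_pmf.expectation p (\<lambda>t. exp (- s * real t)) < exp (- s * y)"
    using integral_exp_less[OF int] y(2) unfolding \<mu>_def by blast
  define \<phi> where "\<phi> = measure_pmf.expectation p (\<lambda>t. exp (- s * real t))"
  \<comment> \<open>\<open>\<rho> ^ l\<close> is the expectation of exp (s (y l - S)), which
    dominates the probability of S < y l.\<close>
  define \<rho> where "\<rho> = exp (s * y) * \<phi>"
  have \<phi>: "\<phi> \<ge> 0" "(\<integral>\<^sup>+ t. ennreal (exp (- s * real t)) \<partial>p) = ennreal \<phi>"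
    unfolding \<phi>_def
    by (auto intro!: nn_integral_eq_integral measure_pmf.integrable_const_bound[where B = 1])
      (use s in auto)
  have "\<rho> < exp (s * y) * exp (- s * y)"
    unfolding \<rho>_def \<phi>_def by (intro mult_strict_left_mono s) auto
  then have \<rho>: "0 \<le> \<rho>" "\<rho> < 1"
    using \<phi> by (auto simp: \<rho>_def simp flip: exp_add)
  have "(\<lambda>l. c * \<mu> / y + c * \<mu> * \<rho> ^ l) \<longlonglongrightarrow> c * \<mu> / y + c * \<mu> * 0"
    using \<rho> by (intro tendsto_intros LIMSEQ_realpow_zero) auto
  then have "\<forall>\<^sub>F l in sequentially. c * \<mu> / y + c * \<mu> * \<rho> ^ l < 1"
    by (rule order_tendstoD) (use y in auto)
  then show ?thesis
    using eventually_gt_at_top[of 0]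
  proof eventually_elim
    case (elim l)
    \<comment> \<open>The first term handles S \<ge> y l. In the second, exp (s (y l - S)) exceeds 1
      when S < y l and replaces the indicator of that event.\<close>
    have *: "c * \<mu> / real (sum_list ts) \<le> c * \<mu> / y / real l +
        c * \<mu> * exp (s * y * real l) / real l * exp (- s * real (sum_list ts))"
      if "ts \<in> set_pmf (replicate_pmf l p)" for ts
    proof -
      have S: "real l \<le> real (sum_list ts)"
        using sum_list_ge_of_set_replicate_pmf[OF that] \<open>0 \<notin> set_pmf p\<close> by simp
      show ?thesis
      proof (cases "y * real l \<le> real (sum_list ts)")
        case True
        have "c * \<mu> / real (sum_list ts) \<le> c * \<mu> / (y * real l)"
          using True S c pos y elim by (intro divide_left_mono mult_nonneg_nonneg mult_pos_pos) auto
        then show ?thesis using c pos by (simp add: add_increasing2)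
      next
        case False
        have "c * \<mu> / real (sum_list ts) \<le> c * \<mu> / real l * 1"
          using S c pos elim by (auto intro!: divide_left_mono mult_pos_pos)
        also have "\<dots> \<le> c * \<mu> / real l * exp (s * y * real l + - s * real (sum_list ts))"
          using False s(1) c pos by (intro mult_left_mono) (auto simp: mult.assoc)
        also have "\<dots> = c * \<mu> * exp (s * y * real l) / real l * exp (- s * real (sum_list ts))"
          by (simp only: exp_add) (simp add: field_simps)
        finally show ?thesis using c pos y by (simp add: add_increasing)
      qed
    qed
    have "(\<integral>\<^sup>+ ts. ennreal (c * \<mu> / real (sum_list ts)) \<partial>replicate_pmf l p) \<le>
       (\<integral>\<^sup>+ ts. ennreal (c * \<mu> / y / real l) + ennreal (c * \<mu> * exp (s * y * real l) / real l) *
          ennreal (exp (- s * real (sum_list ts))) \<partial>replicate_pmf l p)"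
      using c pos y *
      by (intro nn_integral_mono_AE)
        (simp add: AE_measure_pmf_iff ennreal_leI flip: ennreal_mult ennreal_plus)
    also have "\<dots> = ennreal (c * \<mu> / y / real l) +
        ennreal (c * \<mu> * exp (s * y * real l) / real l) * ennreal (\<phi> ^ l)"
      using \<phi>
      by (simp add: nn_integral_add nn_integral_cmult nn_integral_exp_sum_list[simplified] ennreal_power)
    also have "\<dots> = ennreal ((c * \<mu> / y + c * \<mu> * \<rho> ^ l) / real l)"
      using c pos y \<phi>(1) exp_of_nat2_mult[of "s * y" l]
      by (simp add: \<rho>_def power_mult_distrib add_divide_distrib mult_ac
          flip: ennreal_mult ennreal_plus)
    also have "\<dots> \<le> ennreal (1 / real l)"
      using elim by (intro ennreal_leI divide_right_mono) auto
    finally show ?case .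
  qed
qed

lemma suffix_weight_eq_exp:
  assumes "pmf q 0 > 0"
  shows "suffix_weight q ts =
    ennreal (exp (- (\<Sum>i<length ts. - ln (measure q {..sum_list (drop i ts)}))))"
  using measure_pmf_atMost_pos[OF assms]
  by (simp add: suffix_weight_def measure_pmf.emeasure_eq_measure prod_ennreal exp_sum sum_negf)

text \<open>The expected exponents \<open>b l\<close> are at most 1 / l from \<open>l0\<close> on,
  so their sum up to \<open>k\<close> is at most ln k plus a constant; Jensen's inequality turns
  this into a multiple of 1 / k.\<close>

lemma emeasure_spent_ge:
  fixes p q :: "nat pmf" and c :: real
  defines "\<mu> \<equiv> measure_pmf.expectation p real"
  assumes int: "integrable p real" and pos: "\<mu> > 0" and p0: "0 \<notin> set_pmf p"
    and q0: "pmf q 0 > 0"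
    and c: "0 \<le> c" "c < 1"
    and ev: "\<forall>\<^sub>F n in sequentially. - ln (measure q {..n}) \<le> c * \<mu> / real n"
  shows "\<exists>C>0. \<forall>k\<ge>1. ennreal (C / real k) \<le> emeasure (replicate_pmf k (pair_pmf p q)) {zs. spent zs}"
proof -
  define g where "g n = - ln (measure q {..n})" for n
  define b where "b l = (\<integral>\<^sup>+ ts. ennreal (g (sum_list ts)) \<partial>replicate_pmf l p)" for l
  \<comment> \<open>The uniform bound \<open>g 0\<close> serves the finitely many
    \<open>l < l0\<close>, where the asymptotic estimates say nothing.\<close>
  have g0: "g n \<ge> 0" and gB: "g n \<le> g 0" for n
    using measure_pmf_atMost_pos[OF q0, of n] measure_pmf_atMost_pos[OF q0, of 0]
      measure_pmf.finite_measure_mono[of "{..0}" "{..n}" q]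
    by (auto simp: g_def)
  obtain n0 where n0: "\<And>n. n \<ge> n0 \<Longrightarrow> g n \<le> c * \<mu> / real n"
    using ev unfolding g_def eventually_sequentially by blast
  obtain l1 where l1: "\<And>l. l \<ge> l1 \<Longrightarrow> (\<integral>\<^sup>+ ts. ennreal (c * \<mu> / real (sum_list ts)) \<partial>replicate_pmf l p)
      \<le> ennreal (1 / real l)"
    using expectation_inverse_sum_list_le[OF int _ p0 c] pos
    unfolding eventually_sequentially \<mu>_def by blast
  \<comment> \<open>Gaps are at least 1, so \<open>l \<ge> n0\<close> already puts the sum of
    \<open>l\<close> gaps in the range where the estimate for \<open>g\<close> holds.\<close>
  define l0 where "l0 = max n0 l1"
  have b1: "b l \<le> ennreal (g 0)" for l
  proof -
    have "b l \<le> (\<integral>\<^sup>+ ts. ennreal (g 0) \<partial>replicate_pmf l p)"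
      unfolding b_def by (intro nn_integral_mono ennreal_leI gB)
    then show ?thesis by simp
  qed
  have b2: "b l \<le> ennreal (1 / real l)" if "l \<ge> l0" for l
  proof -
    have "n0 \<le> sum_list ts" if "ts \<in> set_pmf (replicate_pmf l p)" for ts
      using sum_list_ge_of_set_replicate_pmf[OF that p0] \<open>l \<ge> l0\<close> by (simp add: l0_def)
    then have "b l \<le> (\<integral>\<^sup>+ ts. ennreal (c * \<mu> / real (sum_list ts)) \<partial>replicate_pmf l p)"
      unfolding b_def by (intro nn_integral_mono_AE) (auto simp: AE_measure_pmf_iff ennreal_leI n0)
    also have "\<dots> \<le> ennreal (1 / real l)" using that l1 by (simp add: l0_def)
    finally show ?thesis .
  qed
  \<comment> \<open>\<open>real l0 * g 0\<close> pays for the indices below \<open>l0\<close>; the 1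
    comes from \<open>harm k \<le> ln (real k) + 1\<close>.\<close>
  define D where "D = real l0 * g 0 + 1"
  have sum_b: "(\<Sum>l=1..k. b l) \<le> ennreal (D + ln (real k))" if "k \<ge> 1" for k
  proof -
    have "(\<Sum>l=1..k. b l) \<le> (\<Sum>l=1..k. ennreal ((if l < l0 then g 0 else 0) + 1 / real l))"
    proof (intro sum_mono)
      fix l
      show "b l \<le> ennreal ((if l < l0 then g 0 else 0) + 1 / real l)"
        using b1[of l] b2[of l] g0[of 0]
        by (cases "l < l0") (auto intro: order.trans ennreal_leI)
    qed
    also have "\<dots> = ennreal (\<Sum>l=1..k. (if l < l0 then g 0 else 0) + 1 / real l)"
      using g0[of 0] by (intro sum_ennreal) auto
    also have "\<dots> \<le> ennreal (D + ln (real k))"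
    proof (intro ennreal_leI)
      have "(\<Sum>l=1..k. (if l < l0 then g 0 else 0)) = (\<Sum>l\<in>{1..k} \<inter> {..<l0}. g 0)"
        by (subst sum.inter_restrict) auto
      also have "\<dots> \<le> (\<Sum>l\<in>{..<l0}. g 0)"
        using g0 by (intro sum_mono2) auto
      finally have 1: "(\<Sum>l=1..k. (if l < l0 then g 0 else 0)) \<le> real l0 * g 0" by simp
      have 2: "harm k \<le> (ln (real k) + 1 :: real)"
        using that
      proof (induction k rule: nat_induct_at_least)
        case (Suc k)
        have "ln (real k / real (Suc k)) \<le> real k / real (Suc k) - 1"
          using Suc.hyps by (intro ln_le_minus_one) auto
        also have "\<dots> = - inverse (real (Suc k))" by (simp add: field_simps)
        finally show ?case using Suc by (simp add: harm_Suc ln_div)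
      qed (simp add: harm_expand)
      show "(\<Sum>l=1..k. (if l < l0 then g 0 else 0) + 1 / real l) \<le> D + ln (real k)"
        using 1 2 by (simp add: sum.distrib D_def harm_def inverse_eq_divide)
    qed
    finally show ?thesis .
  qed
  have "ennreal (exp (- D) / real k) \<le> emeasure (replicate_pmf k (pair_pmf p q)) {zs. spent zs}"
    if "k \<ge> 1" for k
  proof -
    have "ennreal (exp (- (D + ln (real k)))) \<le>
        (\<integral>\<^sup>+ ts. ennreal (exp (- enn2real (\<Sum>i<k. ennreal (g (sum_list (drop i ts))))))
          \<partial>replicate_pmf k p)"
      using sum_b[OF that] that g0[of 0]
      by (intro nn_integral_exp_neg_ge) (auto simp: nn_integral_sum_list_suffixes[where c = "\<lambda>n. ennreal (g n)"] b_def D_def)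
    also have "\<dots> = (\<integral>\<^sup>+ ts. suffix_weight q ts * 1 \<partial>replicate_pmf k p)"
      by (intro nn_integral_cong_AE)
        (auto simp: AE_measure_pmf_iff set_replicate_pmf suffix_weight_eq_exp[OF q0] g0 g_def[symmetric]
          sum_ennreal sum_nonneg)
    also have "\<dots> = emeasure (replicate_pmf k (pair_pmf p q)) {zs. spent zs}"
      by (subst nn_integral_spent[symmetric]) simp
    finally show ?thesis
      using that by (simp add: exp_diff exp_minus field_simps exp_add)
  qed
  then show ?thesis by (intro exI[of _ "exp (- D)"]) auto
qed

text \<open>For a > 0, -ln a is at most (1 - a) / a. Since \<open>\<alpha> n\<close> eventually
  exceeds any fixed number below 1, the denominator costs a factor that the strict inequality
  absorbs.\<close>

lemma eventually_neg_ln_le: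
  fixes \<alpha> :: "nat \<Rightarrow> real" and \<mu> :: real
  assumes \<mu>: "\<mu> > 0"
    and ls: "limsup (\<lambda>n. ereal (real n * inverse \<mu> * (1 - \<alpha> n))) < 1"
  shows "\<exists>c. 0 \<le> c \<and> c < 1 \<and> (\<forall>\<^sub>F n in sequentially. - ln (\<alpha> n) \<le> c * \<mu> / real n)"
proof -
  obtain c0 where c0: "limsup (\<lambda>n. ereal (real n * inverse \<mu> * (1 - \<alpha> n))) < ereal c0" "ereal c0 < 1"
    using ereal_dense2[OF ls] by blast
  \<comment> \<open>\<open>c0\<close> may be nonpositive; the maximum makes \<open>c\<close>
    positive. Dividing by the lower bound \<open>c / c1\<close> for \<open>\<alpha> n\<close> raises
    \<open>c\<close> to \<open>c1\<close>, still below 1.\<close>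
  define c where "c = max c0 (1/2)"
  define c1 where "c1 = (1 + c) / 2"
  have c: "0 < c" "c < c1" "c1 < 1"
    using c0(2) by (auto simp: c_def c1_def)
  have "(\<lambda>n. 1 - c * \<mu> / real n) \<longlonglongrightarrow> 1" by real_asymp
  then have "\<forall>\<^sub>F n in sequentially. c / c1 < 1 - c * \<mu> / real n"
    by (rule order_tendstoD) (use c in simp)
  moreover have "\<forall>\<^sub>F n in sequentially. ereal (real n * inverse \<mu> * (1 - \<alpha> n)) < ereal c0"
    using c0(1) by (rule Limsup_lessD)
  ultimately have "\<forall>\<^sub>F n in sequentially. - ln (\<alpha> n) \<le> c1 * \<mu> / real n"
    using eventually_gt_at_top[of 0]
  proof eventually_elim
    case (elim n)
    have "real n * inverse \<mu> * (1 - \<alpha> n) \<le> c"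
      using elim(2) by (simp add: c_def)
    then have 1: "1 - \<alpha> n \<le> c * \<mu> / real n"
      using elim(3) \<mu> by (simp add: field_simps)
    then have 2: "c / c1 < \<alpha> n" using elim(1) by simp
    then have 3: "0 < \<alpha> n" using c by (auto intro: less_trans[of _ "c / c1"])
    have "- ln (\<alpha> n) = ln (1 / \<alpha> n)"
      using 3 by (simp add: ln_div)
    also have "\<dots> \<le> 1 / \<alpha> n - 1"
      using 3 by (intro ln_le_minus_one) simp
    also have "\<dots> = (1 - \<alpha> n) / \<alpha> n"
      using 3 by (simp add: field_simps)
    also have "\<dots> \<le> (c * \<mu> / real n) / (c / c1)"
      using 1 2 c \<mu> by (intro frac_le) auto
    also have "\<dots> = c1 * \<mu> / real n"
      using c by simp
    finally show ?case .
  qed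
  then show ?thesis using c by (intro exI[of _ c1]) auto
qed

section \<open>From the renewal sequence to lists\<close>

definition arrival :: "(nat \<Rightarrow> 'a \<Rightarrow> nat) \<Rightarrow> nat \<Rightarrow> 'a \<Rightarrow> nat" where
  "arrival Ts n \<omega> = (\<Sum>k<n. Ts (Suc k) \<omega>)"

lemma arrival_0 [simp]: "arrival Ts 0 \<omega> = 0"
  and arrival_Suc [simp]: "arrival Ts (Suc n) \<omega> = arrival Ts n \<omega> + Ts (Suc n) \<omega>"
  by (simp_all add: arrival_def)

text \<open>The empty sum, an arrival at 0, absorbs the separate case \<open>i = 0\<close>.\<close>

lemma renewal_eq: "renewal Ts i \<omega> = (if \<exists>n. arrival Ts n \<omega> = i then 1 else 0)"
proof -
  have *: "arrival Ts n \<omega> = (\<Sum>k=1..n. Ts k \<omega>)" for n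
    unfolding arrival_def by (rule sum.reindex_bij_witness[of _ "\<lambda>k. k - 1" Suc]) auto
  show ?thesis
    unfolding renewal_def *[symmetric] by (metis One_nat_def Suc_leI arrival_0 gr0I)
qed

text \<open>
  \<open>R\<close> is independent of the renewal sequence, not necessarily of \<open>Ts\<close>. The first gaps are
  therefore expressed by an event in terms of the renewal sequence alone.
\<close>

definition start_pattern :: "nat list \<Rightarrow> (nat \<Rightarrow> nat) set" where
  "start_pattern ts = {x. \<forall>j<length ts.
     (\<forall>i. 0 < i \<and> i < ts ! j \<longrightarrow> x (sum_list (take j ts) + i) = 0) \<and>
     x (sum_list (take j ts) + ts ! j) = 1}"

lemma sets_start_pattern:
  "start_pattern ts \<in> sets (PiM UNIV (\<lambda>_. count_space UNIV))"
proof -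
  have "Measurable.pred (PiM UNIV (\<lambda>_. count_space UNIV)) (\<lambda>x :: nat \<Rightarrow> nat. \<forall>j<length ts.
     (\<forall>i. 0 < i \<and> i < ts ! j \<longrightarrow> x (sum_list (take j ts) + i) = 0) \<and>
     x (sum_list (take j ts) + ts ! j) = 1)"
    by measurable
  then show ?thesis
    unfolding start_pattern_def pred_def by (simp add: space_PiM)
qed

lemma arrival_eq_sum_list:
  assumes "\<forall>j<k. Ts (Suc j) \<omega> = ts ! j" "k \<le> length ts"
  shows "arrival Ts k \<omega> = sum_list (take k ts)"
  using assms by (induction k) (auto simp: take_Suc_conv_app_nth)

section \<open>Pathwise facts when all gaps are positive\<close>

context
  fixes Ts :: "nat \<Rightarrow> 'a \<Rightarrow> nat" and \<omega> :: 'a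
  assumes pos: "\<And>k. k \<ge> 1 \<Longrightarrow> Ts k \<omega> \<ge> 1"
begin

lemma strict_mono_arrival: "strict_mono (\<lambda>n. arrival Ts n \<omega>)"
  using pos by (intro strict_monoI_Suc) (auto simp: Suc_le_eq)

text \<open>Arrival times increase strictly, so arrival \<open>Suc n\<close> is the first renewal
  point after arrival \<open>n\<close>.\<close>

lemma next_arrival_iff:
  assumes "t \<ge> 1"
  shows "(\<forall>i. 0 < i \<and> i < t \<longrightarrow> renewal Ts (arrival Ts n \<omega> + i) \<omega> = 0) \<and>
      renewal Ts (arrival Ts n \<omega> + t) \<omega> = 1 \<longleftrightarrow> Ts (Suc n) \<omega> = t"
    (is "?L \<longleftrightarrow> ?R")
proof
  assume L: ?L
  then obtain m where m: "arrival Ts m \<omega> = arrival Ts n \<omega> + t"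
    by (auto simp: renewal_eq split: if_splits)
  then have "n < m"
    using strict_mono_less[OF strict_mono_arrival, of n m] assms by simp
  then have "Ts (Suc n) \<omega> \<le> t"
    using strict_mono_less_eq[OF strict_mono_arrival, of "Suc n" m] m by simp
  moreover have "renewal Ts (arrival Ts n \<omega> + Ts (Suc n) \<omega>) \<omega> = 1"
    by (auto simp: renewal_eq intro!: exI[of _ "Suc n"])
  ultimately show ?R
    using L pos[of "Suc n"] by (cases "Ts (Suc n) \<omega> < t") auto
next
  assume R: ?R
  have "arrival Ts m \<omega> \<noteq> arrival Ts n \<omega> + i" if "0 < i" "i < t" for m i
  proof
    assume "arrival Ts m \<omega> = arrival Ts n \<omega> + i"
    then have "n < m" "m < Suc n"
      using that R strict_mono_less[OF strict_mono_arrival, of n m]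
        strict_mono_less[OF strict_mono_arrival, of m "Suc n"] by auto
    then show False by simp
  qed
  moreover have "\<exists>m. arrival Ts m \<omega> = arrival Ts n \<omega> + t"
    using R by (intro exI[of _ "Suc n"]) simp
  ultimately show ?L by (auto simp: renewal_eq)
qed

text \<open>The pattern uses positions computed from \<open>ts\<close>; these are true arrival times
  once the earlier gaps agree, hence the induction on the number of gaps.\<close>

lemma start_pattern_iff:
  assumes "\<forall>t\<in>set ts. t \<ge> 1"
  shows "(\<lambda>i. renewal Ts i \<omega>) \<in> start_pattern ts \<longleftrightarrow> (\<forall>j<length ts. Ts (Suc j) \<omega> = ts ! j)"
proof -
  have "(\<forall>j<k. (\<forall>i. 0 < i \<and> i < ts ! j \<longrightarrow> renewal Ts (sum_list (take j ts) + i) \<omega> = 0) \<and>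
     renewal Ts (sum_list (take j ts) + ts ! j) \<omega> = 1) \<longleftrightarrow> (\<forall>j<k. Ts (Suc j) \<omega> = ts ! j)"
    if "k \<le> length ts" for k
    using that
  proof (induction k)
    case (Suc k)
    show ?case
    proof (cases "\<forall>j<k. Ts (Suc j) \<omega> = ts ! j")
      case True
      then have "arrival Ts k \<omega> = sum_list (take k ts)"
        using Suc.prems by (intro arrival_eq_sum_list) auto
      moreover have "ts ! k \<ge> 1" using assms Suc.prems by auto
      ultimately show ?thesis
        using Suc next_arrival_iff[of "ts ! k" k] by (simp add: All_less_Suc)
    next
      case False
      with Suc show ?thesis by (metis Suc_leD less_SucI)
    qed
  qed simp
  then show ?thesis by (simp add: start_pattern_def)
qed

text \<open>An interval containing arrival \<open>n \<ge> 1\<close> starts at an earlier arrival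
  \<open>j\<close>, and the gaps in between add up to the distance that its reach must
  bridge.\<close>

lemma covered_if_covering:
  assumes "(\<Union>i. cover_interval (renewal Ts) Rs i \<omega>) = {1..}"
  shows "covered (map (\<lambda>j. (Ts (Suc j) \<omega>, Rs (arrival Ts j \<omega>) \<omega>)) [0..<k])"
    (is "covered (map ?f _)")
proof -
  have "reached (map ?f [0..<n])" if "n \<ge> 1" for n
  proof -
    have "1 \<le> arrival Ts n \<omega>"
      using strict_mono_less[OF strict_mono_arrival, of 0 n] that by simp
    then obtain i where "arrival Ts n \<omega> \<in> cover_interval (renewal Ts) Rs i \<omega>"
      using assms by (metis UN_iff atLeast_iff)
    then have i: "renewal Ts i \<omega> = 1" "i < arrival Ts n \<omega>" "arrival Ts n \<omega> \<le> i + Rs i \<omega>"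
      by (auto simp: cover_interval_def split: if_splits)
    then obtain j where j: "i = arrival Ts j \<omega>"
      by (auto simp: renewal_eq split: if_splits)
    then have "j < n"
      using i(2) strict_mono_less[OF strict_mono_arrival, of j n] by simp
    have "sum_list (map fst (drop j (map ?f [0..<n]))) = (\<Sum>k\<in>{j..<n}. Ts (Suc k) \<omega>)"
      by (simp add: drop_map comp_def interv_sum_list_conv_sum_set_nat)
    also have "\<dots> + arrival Ts j \<omega> = arrival Ts n \<omega>"
      using \<open>j < n\<close> sum.atLeastLessThan_concat[of 0 j n "\<lambda>k. Ts (Suc k) \<omega>"]
      by (simp add: arrival_def atLeast0LessThan)
    finally show ?thesis
      using i(3) j \<open>j < n\<close> unfolding reached_iff by (intro exI[of _ j]) auto
  qed
  then show ?thesis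
    by (auto simp: covered_def take_map)
qed

end

lemma sets_coverage_event:
  assumes "\<And>i. \<xi> i \<in> measurable M (count_space UNIV)"
    "\<And>i. Rs i \<in> measurable M (count_space UNIV)"
  shows "coverage_event M \<xi> Rs \<in> sets M"
proof -
  note [measurable] = assms
  have "coverage_event M \<xi> Rs = {\<omega> \<in> space M. \<forall>n. n \<ge> 1 \<longleftrightarrow>
      (\<exists>i. \<xi> i \<omega> = 1 \<and> Rs i \<omega> \<ge> 1 \<and> i + 1 \<le> n \<and> n \<le> i + Rs i \<omega>)}"
    unfolding coverage_event_def cover_interval_def set_eq_iff by (auto split: if_splits)
  also have "\<dots> \<in> sets M" by measurable
  finally show ?thesis .
qed

text \<open>
  \<open>Ts k\<close> is only almost surely positive, so the gaps are recovered from the renewal sequence up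
  to a null set.
\<close>

lemma (in prob_space) emeasure_coverage_event_le:
  fixes p q :: "nat pmf"
  assumes Ts: "indep_vars (\<lambda>_. count_space UNIV) Ts {1..}"
    "\<And>k. k \<ge> 1 \<Longrightarrow> distr M (count_space UNIV) (Ts k) = measure_pmf p"
    and Rs: "indep_vars (\<lambda>_. count_space UNIV) Rs UNIV"
    "\<And>i. distr M (count_space UNIV) (Rs i) = measure_pmf q"
    and indep: "indep_var
      (PiM UNIV (\<lambda>_. count_space UNIV)) (\<lambda>\<omega> i. renewal Ts i \<omega>)
      (PiM UNIV (\<lambda>_. count_space UNIV)) (\<lambda>\<omega> i. Rs i \<omega>)"
    and p0: "0 \<notin> set_pmf p"
  shows "emeasure M (coverage_event M (renewal Ts) Rs) \<le>
    emeasure (replicate_pmf k (pair_pmf p q)) {zs. covered zs}"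
proof -
  define C where "C = {zs. length zs = k \<and> covered zs \<and> (\<forall>z\<in>set zs. fst z \<ge> 1)}"
  \<comment> \<open>Once \<open>zs\<close> prescribes the gaps, the arrival positions are the fixed
    numbers \<open>s zs j\<close>, so the reaches are read at deterministic indices.\<close>
  define s where "s zs j = sum_list (take j (map fst zs))" for zs :: "(nat \<times> nat) list" and j
  define ET where "ET zs = {\<omega> \<in> space M. \<forall>j<k. Ts (Suc j) \<omega> = fst (zs ! j)}" for zs :: "(nat \<times> nat) list"
  define ER where "ER zs = {\<omega> \<in> space M. \<forall>j<k. Rs (s zs j) \<omega> = snd (zs ! j)}" for zs
  define E where "E zs = ET zs \<inter> ER zs" for zs
  define L where "L \<omega> = map (\<lambda>j. (Ts (Suc j) \<omega>, Rs (arrival Ts j \<omega>) \<omega>)) [0..<k]" for \<omega>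
  have [measurable]: "Ts k \<in> measurable M (count_space UNIV)" if "k \<ge> 1" for k
    using Ts(1) that by (auto simp: indep_vars_def)
  have [measurable]: "Rs k \<in> measurable M (count_space UNIV)" for k
    using Rs(1) by (auto simp: indep_vars_def)
  have Emeas: "ET zs \<in> sets M" "ER zs \<in> sets M" "E zs \<in> sets M" for zs
    unfolding E_def ET_def ER_def by measurable
  \<comment> \<open>On lists of length \<open>k\<close>, the sets \<open>E zs\<close> are the fibres
    of \<open>L\<close>, hence disjoint.\<close>
  have L_E: "L \<omega> = zs" if "\<omega> \<in> E zs" "length zs = k" for \<omega> zs
  proof (rule nth_equalityI)
    fix j assume "j < length (L \<omega>)"
    then have "j < k" by (simp add: L_def)
    have "arrival Ts j \<omega> = s zs j"
      using that \<open>j < k\<close> unfolding s_def E_def ET_def by (intro arrival_eq_sum_list) auto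
    then show "L \<omega> ! j = zs ! j"
      using that \<open>j < k\<close> by (auto simp: L_def E_def ET_def ER_def prod_eq_iff)
  qed (use that in \<open>simp add: L_def\<close>)
  have E_L: "\<omega> \<in> E (L \<omega>)" if "\<omega> \<in> space M" for \<omega>
  proof -
    have "arrival Ts j \<omega> = s (L \<omega>) j" if "j < k" for j
      using that unfolding s_def by (intro arrival_eq_sum_list) (auto simp: L_def)
    then show ?thesis
      using that by (auto simp: E_def ET_def ER_def L_def)
  qed
  have "AE \<omega> in M. Ts j \<omega> \<ge> 1" if "j \<ge> 1" for j
  proof -
    have "AE t in distr M (count_space UNIV) (Ts j). t \<ge> 1"
      unfolding Ts(2)[OF that] AE_measure_pmf_iff using p0 by (metis One_nat_def Suc_leI gr0I)
    then show ?thesis using that by (subst (asm) AE_distr_iff) auto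
  qed
  then have "AE \<omega> in M. \<forall>j\<in>{1..}. Ts j \<omega> \<ge> 1"
    by (subst AE_ball_countable) auto
  then have pos: "AE \<omega> in M. \<forall>j\<ge>1. Ts j \<omega> \<ge> 1"
    by (simp add: Ball_def)
  have prob_E: "emeasure M (E zs) = ennreal (pmf (replicate_pmf k (pair_pmf p q)) zs)" if "zs \<in> C" for zs
  proof -
    have zs: "length zs = k" "\<forall>t\<in>set (map fst zs). t \<ge> 1"
      using that by (auto simp: C_def)
    define B where "B = (\<lambda>\<omega> i. renewal Ts i \<omega>) -` start_pattern (map fst zs) \<inter> space M"
    \<comment> \<open>Positive gaps keep the positions distinct, so the reaches involved are
      different members of the i.i.d. family.\<close>
    have "inj_on (s zs) {..<k}"
    proof (rule linorder_inj_onI)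
      fix i j assume "i < j" "i \<in> {..<k}" "j \<in> {..<k}"
      then have "s zs j = s zs i + sum_list (take (j - i) (drop i (map fst zs)))"
        unfolding s_def using take_add[of i "j - i" "map fst zs"] by simp
      moreover have "take (j - i) (drop i (map fst zs)) =
          fst (zs ! i) # take (j - i - 1) (drop (Suc i) (map fst zs))"
        using \<open>i < j\<close> \<open>i \<in> {..<k}\<close> zs(1)
        by (cases "j - i") (auto simp: Cons_nth_drop_Suc[symmetric])
      moreover have "fst (zs ! i) \<ge> 1"
        using zs \<open>i \<in> {..<k}\<close> by auto
      ultimately show "s zs i \<noteq> s zs j" by simp
    qed auto
    then have prob_ER: "prob (ER zs) = (\<Prod>j<k. pmf q (snd (zs ! j)))"
      unfolding ER_def by (intro prob_indep_vars_eq[OF Rs(1)] Rs(2)) auto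
    have prob_ET: "prob (ET zs) = (\<Prod>j<k. pmf p (fst (zs ! j)))"
      unfolding ET_def by (intro prob_indep_vars_eq[OF Ts(1)] Ts(2)) auto
    have B_ET: "AE \<omega> in M. \<omega> \<in> B \<longleftrightarrow> \<omega> \<in> ET zs"
      using pos
    proof eventually_elim
      case (elim \<omega>)
      then show ?case
        using start_pattern_iff[OF _ zs(2), of Ts \<omega>] zs(1) by (auto simp: B_def ET_def)
    qed
    have [measurable]: "B \<in> sets M"
      unfolding B_def using indep_var_rv1[OF indep] sets_start_pattern by (rule measurable_sets)
    define P where "P = {x :: nat \<Rightarrow> nat. \<forall>j<k. x (s zs j) = snd (zs ! j)}"
    have "Measurable.pred (PiM UNIV (\<lambda>_. count_space UNIV)) (\<lambda>x :: nat \<Rightarrow> nat. \<forall>j<k. x (s zs j) = snd (zs ! j))"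
      by measurable
    then have P: "P \<in> sets (PiM UNIV (\<lambda>_. count_space UNIV))"
      unfolding P_def pred_def by (simp add: space_PiM)
    have ER: "ER zs = (\<lambda>\<omega> i. Rs i \<omega>) -` P \<inter> space M"
      by (auto simp: ER_def P_def)
    have "prob (E zs) = prob (B \<inter> ER zs)"
      using B_ET Emeas unfolding E_def by (intro finite_measure_eq_AE) (auto elim: eventually_mono)
    also have "B \<inter> ER zs =
        (\<lambda>\<omega>. (\<lambda>i. renewal Ts i \<omega>, \<lambda>i. Rs i \<omega>)) -` (start_pattern (map fst zs) \<times> P) \<inter> space M"
      unfolding ER B_def by auto
    also have "prob \<dots> = prob B * prob (ER zs)"
      unfolding B_def ER by (rule indep_varD[OF indep sets_start_pattern P])
    also have "prob B = prob (ET zs)"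
      using B_ET Emeas by (intro finite_measure_eq_AE) auto
    finally have "prob (E zs) = (\<Prod>j<k. pmf (pair_pmf p q) (zs ! j))"
      using pmf_pair[of p q "fst z" "snd z" for z]
      by (simp add: prob_ER prob_ET prod.distrib)
    then show ?thesis
      using zs(1) by (simp add: emeasure_eq_measure pmf_replicate_pmf)
  qed
  have "emeasure M (coverage_event M (renewal Ts) Rs) \<le> emeasure M (\<Union>zs\<in>C. E zs)"
  proof (rule emeasure_mono_AE)
    show "AE \<omega> in M. \<omega> \<in> coverage_event M (renewal Ts) Rs \<longrightarrow> \<omega> \<in> (\<Union>zs\<in>C. E zs)"
      using pos
    proof eventually_elim
      case (elim \<omega>)
      show ?case
      proof
        assume \<omega>: "\<omega> \<in> coverage_event M (renewal Ts) Rs"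
        then have "covered (L \<omega>)"
          unfolding L_def using elim by (intro covered_if_covering) (auto simp: coverage_event_def)
        then have "L \<omega> \<in> C"
          using elim by (auto simp: C_def L_def)
        then show "\<omega> \<in> (\<Union>zs\<in>C. E zs)"
          using E_L \<omega> by (auto simp: coverage_event_def)
      qed
    qed
  qed (use Emeas in auto)
  also have "\<dots> = (\<integral>\<^sup>+ zs. emeasure M (E zs) \<partial>count_space C)"
    using Emeas L_E by (intro emeasure_UN_countable) (auto simp: disjoint_family_on_def C_def, blast)
  also have "\<dots> = (\<integral>\<^sup>+ zs. ennreal (pmf (replicate_pmf k (pair_pmf p q)) zs) \<partial>count_space C)"
    by (intro nn_integral_cong) (simp add: prob_E)
  also have "\<dots> = emeasure (replicate_pmf k (pair_pmf p q)) C"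
    by (rule nn_integral_pmf)
  also have "\<dots> \<le> emeasure (replicate_pmf k (pair_pmf p q)) {zs. covered zs}"
    by (intro emeasure_mono) (auto simp: C_def)
  finally show ?thesis .
qed

section \<open>Divergence of the harmonic series and conclusion\<close>

lemma eq_0_if_renewal_sum_bounded:
  fixes u :: "nat \<Rightarrow> ennreal" and a :: ennreal
  assumes C: "C > 0" "\<And>k. k \<ge> 1 \<Longrightarrow> ennreal (C / real k) \<le> u k"
    and le: "\<And>N. (\<Sum>n<N. u n) * a \<le> 1"
  shows "a = 0"
proof (rule ccontr)
  assume "a \<noteq> 0"
  \<comment> \<open>\<open>a\<close> could be infinite in \<open>ennreal\<close>; a positive real
    \<open>d\<close> below it allows real arithmetic.\<close>
  then obtain d where d: "d > 0" "ennreal d \<le> a"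
  proof (cases a)
    case (real r)
    then show ?thesis using \<open>a \<noteq> 0\<close> that[of r] by (cases "r = 0") auto
  qed (use that[of 1] in auto)
  have "\<exists>n. harm n > 1 / (C * d)"
    using harm_at_top unfolding filterlim_at_top_dense by (meson eventually_happens trivial_limit_sequentially)
  then obtain n where n: "harm n > 1 / (C * d)" by blast
  have "ennreal (C * harm n) = (\<Sum>k=1..n. ennreal (C / real k))"
    using C(1) by (simp add: harm_def sum_distrib_left inverse_eq_divide sum_ennreal)
  also have "\<dots> \<le> (\<Sum>k=1..n. u k)"
    using C(2) by (intro sum_mono) auto
  also have "\<dots> \<le> (\<Sum>k<Suc n. u k)"
    by (intro sum_mono2) auto
  finally have "ennreal (C * harm n) * ennreal d \<le> (\<Sum>k<Suc n. u k) * a"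
    using d(2) by (rule mult_mono) auto
  also have "\<dots> \<le> 1" by (rule le)
  finally have "ennreal (C * harm n * d) \<le> 1"
    using C(1) d(1) harm_nonneg[of n, where 'a = real] by (subst ennreal_mult) auto
  moreover have "C * harm n * d > 1"
    using n C(1) d(1) by (simp add: field_simps)
  ultimately show False by simp
qed

theorem proposition2:
  fixes M :: "'a measure"
    and T R :: "'a \<Rightarrow> nat"
    and Ts Rs \<xi> :: "nat \<Rightarrow> 'a \<Rightarrow> nat"
    and \<alpha> :: "nat \<Rightarrow> real"
  assumes "prob_space M"
    and "T \<in> measurable M (count_space UNIV)"
    and "\<And>\<omega>. \<omega> \<in> space M \<Longrightarrow> T \<omega> \<ge> 1"
    and "integrable M (\<lambda>\<omega>. real (T \<omega>))"
    and "Gcd {k. k \<ge> 1 \<and> measure M {\<omega> \<in> space M. T \<omega> = k} > 0} = 1"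
    and "prob_space.indep_vars M (\<lambda>_. count_space UNIV) Ts {1..}"
    and "\<And>k. k \<ge> 1 \<Longrightarrow> distr M (count_space UNIV) (Ts k) = distr M (count_space UNIV) T"
    and "\<xi> = renewal Ts"
    and "R \<in> measurable M (count_space UNIV)"
    and "measure M {\<omega> \<in> space M. R \<omega> = 0} > 0"
    and "prob_space.indep_vars M (\<lambda>_. count_space UNIV) Rs UNIV"
    and "\<And>i. distr M (count_space UNIV) (Rs i) = distr M (count_space UNIV) R"
    and "prob_space.indep_var M
           (PiM UNIV (\<lambda>_. count_space UNIV)) (\<lambda>\<omega> i. \<xi> i \<omega>)
           (PiM UNIV (\<lambda>_. count_space UNIV)) (\<lambda>\<omega> i. Rs i \<omega>)"
    and "\<And>n. \<alpha> n = measure M {\<omega> \<in> space M. R \<omega> \<le> n}"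
    and "limsup (\<lambda>n. ereal (real n * inverse (\<integral>\<omega>. real (T \<omega>) \<partial>M) * (1 - \<alpha> n))) < 1"
  shows "coverage_event M \<xi> Rs \<in> sets M \<and> measure M (coverage_event M \<xi> Rs) = 0"
proof -
  interpret prob_space M by fact
  note [measurable] = assms(2,9)
  obtain p where p: "measure_pmf p = distr M (count_space UNIV) T"
    using ex_measure_pmf_eq_distr[OF assms(1,2)] by blast
  obtain q where q: "measure_pmf q = distr M (count_space UNIV) R"
    using ex_measure_pmf_eq_distr[OF assms(1,9)] by blast
  define \<mu> where "\<mu> = measure_pmf.expectation p real"
  have \<mu>: "\<mu> = expectation (\<lambda>\<omega>. real (T \<omega>))"
    unfolding \<mu>_def p by (rule integral_distr) auto
  have int: "integrable p real"
    unfolding p using assms(4) by (subst integrable_distr_eq) auto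
  have "\<mu> \<ge> 1"
    unfolding \<mu> using assms(3,4) by (intro integral_ge_const) (auto intro!: AE_I2)
  then have pos: "\<mu> > 0" by simp
  have "pmf p 0 = prob (T -` {0} \<inter> space M)"
    by (simp add: pmf.rep_eq p measure_distr)
  also have "T -` {0} \<inter> space M = {}"
    using assms(3) by force
  finally have p0: "0 \<notin> set_pmf p"
    by (simp add: set_pmf_iff)
  have \<alpha>: "\<alpha> n = measure q {..n}" for n
    unfolding assms(14) q by (subst measure_distr) (auto intro!: arg_cong[where f = prob])
  have "pmf q 0 = prob {\<omega> \<in> space M. R \<omega> = 0}"
    unfolding pmf.rep_eq q by (subst measure_distr) (auto intro!: arg_cong[where f = prob])
  then have q0: "pmf q 0 > 0"
    using assms(10) by simp
  obtain c where c: "0 \<le> c" "c < 1" "\<forall>\<^sub>F n in sequentially. - ln (measure q {..n}) \<le> c * \<mu> / real n"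
    using eventually_neg_ln_le[OF pos, of \<alpha>] assms(15) unfolding \<mu>[symmetric] \<alpha> by blast
  define Z where "Z = pair_pmf p q"
  obtain C where C: "C > 0" "\<And>k. k \<ge> 1 \<Longrightarrow>
      ennreal (C / real k) \<le> emeasure (replicate_pmf k Z) {zs. spent zs}"
    using emeasure_spent_ge[OF int _ p0 q0 c(1,2)] c(3) pos unfolding \<mu>_def Z_def by blast
  have le: "emeasure M (coverage_event M \<xi> Rs) \<le> emeasure (replicate_pmf m Z) {zs. covered zs}" for m
    unfolding Z_def assms(8) using assms(6,7,11,12,13) p0
    by (intro emeasure_coverage_event_le) (auto simp: p q assms(8))
  \<comment> \<open>The whole product plays the part of \<open>a\<close>. Its first factor equals
    \<open>pmf q 0 > 0\<close>, because gaps are almost surely positive under \<open>p\<close>, so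
    the second factor vanishes.\<close>
  have "emeasure Z {z. fst z \<ge> 1 \<and> snd z = 0} * emeasure M (coverage_event M \<xi> Rs) = 0"
    by (rule eq_0_if_renewal_sum_bounded[OF C renewal_sum_le_1[OF le]])
  moreover have "emeasure Z {z. fst z \<ge> 1 \<and> snd z = 0} = emeasure Z (snd -` {0})"
    using p0 by (intro emeasure_eq_AE)
      (auto simp: AE_measure_pmf_iff Z_def Suc_le_eq intro!: gr0I)
  then have "emeasure Z {z. fst z \<ge> 1 \<and> snd z = 0} = ennreal (pmf q 0)"
    by (simp add: Z_def map_snd_pair_pmf emeasure_pmf_single flip: emeasure_map_pmf)
  ultimately have "emeasure M (coverage_event M \<xi> Rs) = 0"
    using q0 by simp
  moreover have "coverage_event M \<xi> Rs \<in> sets M"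
  proof (rule sets_coverage_event)
    show "\<xi> i \<in> measurable M (count_space UNIV)" for i
      using measurable_compose[OF indep_var_rv1[OF assms(13)] measurable_component_singleton[of i]]
      by simp
    show "Rs i \<in> measurable M (count_space UNIV)" for i
      using assms(11) by (auto simp: indep_vars_def)
  qed
  ultimately show ?thesis
    by (simp add: measure_def)
qed

end
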